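(* Let $m\ge1$, $1\le p<\infty$ and $f,g\in L^p(\mathbb R^m)$. Then $$\int_{\mathbb R^m\times\mathbb R^m}|g(y-x)f(x)-g(x-y)f(y)|^p\,dx\,dy\ \ge\ \int_{\mathbb R^m}\big|\,|g(y)|-|g(-y)|\,\big|^p\,dy\int_{\mathbb R^m}|f(x)|^p\,dx.$$ *)

theory Defs
  imports "HOL-Analysis.Analysis"
begin

text \<open>
  Elements of \<open>L\<^sup>p\<close> are represented by pointwise functions, measurable with respect to
  the completed Lebesgue measure, instead of by equivalence classes modulo null sets.
\<close>

definition Lp :: "real \<Rightarrow> ('a::euclidean_space \<Rightarrow> 'b::{real_normed_vector, second_countable_topology}) set"
  where "Lp p = {f. f \<in> borel_measurable lebesgue \<and>
                    (\<integral>\<^sup>+ x. ennreal (norm (f x) powr p) \<partial>lebesgue) < \<infinity>}"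

end

theory Submission
  imports Defs
begin

text \<open>
  Substituting \<open>y = x + z\<close> turns the left-hand side into
  \<open>\<integral>\<integral> |g(z) f(x) - g(-z) f(x + z)|\<^sup>p dx dz\<close>.  For each fixed \<open>z\<close>, the two functions
  \<open>x \<mapsto> g(z) f(x)\<close> and \<open>x \<mapsto> g(-z) f(x + z)\<close> have the \<open>L\<^sup>p\<close> norms \<open>|g(z)| \<parallel>f\<parallel>\<close> and
  \<open>|g(-z)| \<parallel>f\<parallel>\<close> because Lebesgue measure is translation invariant, so the reverse triangle
  inequality in \<open>L\<^sup>p\<close> bounds the inner integral below by
  \<open>| |g(z)| - |g(-z)| |\<^sup>p \<parallel>f\<parallel>\<^sup>p\<close>; integrating over \<open>z\<close> gives the claim.

  Minkowski's inequality itself can be avoided.  Since the two functions are multiples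
  \<open>a s\<close> and \<open>b r\<close> of functions \<open>s\<close>, \<open>r\<close> with \<^emph>\<open>equal\<close> norms, the constant in the
  convexity inequality is known in advance and the bound already holds pointwise, before
  integration (\<open>powr_weighted_bound\<close>, \<open>reverse_triangle_nn_integral\<close>).

  The remaining work is measure theoretic.  The integrand is a function on the completion of
  the product measure, whereas Tonelli's theorem speaks of the product measure itself.  So
  \<open>f\<close> and \<open>g\<close> are first replaced by Borel functions that agree with them outside a null set
  (\<open>completion_borel_version\<close>); the exceptional sets stay null after composing with
  \<open>(x, y) \<mapsto> y - x\<close> and \<open>(x, y) \<mapsto> x - y\<close> (\<open>AE_lborel_pair\<close>).
\<close>

section \<open>A reverse triangle inequality\<close>

text \<open>
  Convexity extends from the open to the closed half-line because, at a vanishing argument,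
  it reduces to \<open>t\<^sup>p \<le> t\<close> for \<open>t\<close> in the unit interval.
\<close>

lemma powr_convex_nonneg:
  fixes p t x y :: real
  assumes p: "1 \<le> p" and t: "0 \<le> t" "t \<le> 1" and x: "0 \<le> x" and y: "0 \<le> y"
  shows "(t * x + (1 - t) * y) powr p \<le> t * x powr p + (1 - t) * y powr p"
proof -
  have scale: "(t * x) powr p \<le> t * x powr p" if "0 \<le> t" "t \<le> 1" "0 \<le> x" for t x :: real
  proof -
    have "t powr p \<le> t powr 1"
      using p that by (intro powr_mono') auto
    then show ?thesis
      using that by (simp add: powr_mult mult_right_mono)
  qed
  show ?thesis
  proof (cases "x = 0 \<or> y = 0")
    case True
    then show ?thesis
      using scale[of t x] scale[of "1 - t" y] t x y by auto
  next
    case False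
    then show ?thesis
      using convex_onD[OF powr_convex[OF p], of "1 - t" x y] t x y by (simp add: algebra_simps)
  qed
qed

text \<open>
  The hypothesis bounds \<open>s\<close> by the convex combination of \<open>r\<close> and \<open>w / (a - b)\<close> with weights
  \<open>b / a\<close> and \<open>(a - b) / a\<close>, to which convexity of the power applies.  These weights make the
  integrated bound sharp when \<open>s\<close> and \<open>r\<close> have the same norm: equality holds for \<open>s = r\<close> and
  \<open>w = (a - b) s\<close>.
\<close>

lemma powr_weighted_bound:
  fixes a b p r s w :: real
  assumes p: "1 \<le> p" and b: "0 \<le> b" "b < a" and nonneg: "0 \<le> r" "0 \<le> s" "0 \<le> w"
    and le: "a * s \<le> w + b * r"
  shows "a * s powr p \<le> b * r powr p + (a - b) powr (1 - p) * w powr p"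
proof -
  define t where "t = b / a"
  have a: "0 < a" and t: "0 \<le> t" "t \<le> 1" and t': "1 - t = (a - b) / a"
    using b by (auto simp: t_def field_simps)
  have "s \<le> (w + b * r) / a"
    using le a by (simp add: pos_le_divide_eq mult.commute)
  also have "\<dots> = t * r + (1 - t) * (w / (a - b))"
    unfolding t' unfolding t_def using b by (simp add: add_divide_distrib)
  finally have "s \<le> t * r + (1 - t) * (w / (a - b))" .
  then have "s powr p \<le> (t * r + (1 - t) * (w / (a - b))) powr p"
    using nonneg p by (intro powr_mono2) auto
  also have "\<dots> \<le> t * r powr p + (1 - t) * (w / (a - b)) powr p"
    using p t nonneg b by (intro powr_convex_nonneg) auto
  finally have "a * s powr p \<le> a * (t * r powr p + (1 - t) * (w / (a - b)) powr p)"
    using a by (simp add: mult_left_mono)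
  also have "\<dots> = b * r powr p + (a - b) * (w / (a - b)) powr p"
    unfolding t' unfolding t_def using a by (simp add: distrib_left)
  also have "(a - b) * (w / (a - b)) powr p = (a - b) powr (1 - p) * w powr p"
    using b nonneg by (simp add: powr_divide powr_diff)
  finally show ?thesis .
qed

text \<open>
  Integrating the pointwise bound gives \<open>a I \<le> b I + (a - b)\<^sup>1\<^sup>-\<^sup>p D\<close>, where \<open>I\<close> is the common
  integral of \<open>s\<^sup>p\<close> and \<open>r\<^sup>p\<close> and \<open>D\<close> that of \<open>w\<^sup>p\<close>.  Finiteness of \<open>I\<close> is what permits
  cancelling \<open>b I\<close>.
\<close>

lemma reverse_triangle_nn_integral:
  fixes r s w :: "'a \<Rightarrow> real" and a b p :: real
  assumes p: "1 \<le> p" and b: "0 \<le> b" "b < a"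
    and [measurable]: "r \<in> borel_measurable M" "s \<in> borel_measurable M" "w \<in> borel_measurable M"
    and nonneg: "\<And>x. 0 \<le> r x" "\<And>x. 0 \<le> s x" "\<And>x. 0 \<le> w x"
    and le: "\<And>x. a * s x \<le> w x + b * r x"
    and I: "(\<integral>\<^sup>+ x. ennreal (s x powr p) \<partial>M) = I" "(\<integral>\<^sup>+ x. ennreal (r x powr p) \<partial>M) = I"
    and fin: "I < \<infinity>"
  shows "ennreal ((a - b) powr p) * I \<le> (\<integral>\<^sup>+ x. ennreal (w x powr p) \<partial>M)" (is "_ \<le> ?D")
proof (cases "?D = \<infinity>")
  case False
  then obtain d where d: "?D = ennreal d" "0 \<le> d"
    by (metis ennreal_cases infinity_ennreal_def)
  obtain i where i: "I = ennreal i" "0 \<le> i"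
    using fin by (metis ennreal_cases infinity_ennreal_def less_irrefl)
  define c where "c = (a - b) powr (1 - p)"
  have c: "0 \<le> c" "0 \<le> a"
    using b by (auto simp: c_def)
  have "ennreal a * I = (\<integral>\<^sup>+ x. ennreal (a * s x powr p) \<partial>M)"
    using c by (simp add: I(1)[symmetric] nn_integral_cmult ennreal_mult)
  also have "\<dots> \<le> (\<integral>\<^sup>+ x. ennreal b * ennreal (r x powr p) + ennreal c * ennreal (w x powr p) \<partial>M)"
  proof (rule nn_integral_mono)
    fix x
    have "ennreal (a * s x powr p) \<le> ennreal (b * r x powr p + c * w x powr p)"
      unfolding c_def using powr_weighted_bound[OF p b nonneg le] by (rule ennreal_leI)
    then show "ennreal (a * s x powr p)
        \<le> ennreal b * ennreal (r x powr p) + ennreal c * ennreal (w x powr p)"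
      using b c by (simp add: ennreal_mult)
  qed
  also have "\<dots> = ennreal b * I + ennreal c * ?D"
    by (simp add: nn_integral_add nn_integral_cmult I)
  finally have "a * i \<le> b * i + c * d"
    using b c d i by (simp flip: ennreal_mult ennreal_plus)
  then have "(a - b) powr (p - 1) * ((a - b) * i) \<le> (a - b) powr (p - 1) * (c * d)"
    by (intro mult_left_mono) (auto simp: algebra_simps)
  moreover have "(a - b) powr (p - 1) * (a - b) = (a - b) powr p"
    using b by (simp add: powr_diff)
  moreover have "(a - b) powr (p - 1) * c = 1"
    using b by (simp add: c_def flip: powr_add)
  ultimately have "(a - b) powr p * i \<le> d"
    by (simp flip: mult.assoc)
  then show ?thesis
    using d i by (simp flip: ennreal_mult)
qed simp

section \<open>Translations and reflections of Lebesgue measure\<close>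

lemma lborel_distr_reflect:
  fixes c :: "'a::euclidean_space"
  shows "distr lborel borel (\<lambda>x. c - x) = lborel"
  by (subst lborel_affine[of "-1" c]) (auto simp: density_1)

lemma nn_integral_lborel_translate:
  fixes h :: "'a::euclidean_space \<Rightarrow> ennreal"
  assumes "h \<in> borel_measurable borel"
  shows "(\<integral>\<^sup>+ x. h (c + x) \<partial>lborel) = (\<integral>\<^sup>+ x. h x \<partial>lborel)"
  using nn_integral_distr[of "(+) c" lborel borel h] assms by (simp add: lborel_distr_plus)

text \<open>The inner integral after the substitution, for a fixed difference \<open>z\<close>.\<close>

lemma translation_lower_bound:
  fixes f :: "'b::euclidean_space \<Rightarrow> 'a::{real_normed_field, second_countable_topology}"
  assumes p: "1 \<le> p" and f[measurable]: "f \<in> borel_measurable borel"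
    and fin: "(\<integral>\<^sup>+ x. ennreal (norm (f x) powr p) \<partial>lborel) < \<infinity>"
  shows "ennreal (\<bar>norm \<alpha> - norm \<beta>\<bar> powr p) * (\<integral>\<^sup>+ x. ennreal (norm (f x) powr p) \<partial>lborel)
         \<le> (\<integral>\<^sup>+ x. ennreal (norm (\<alpha> * f x - \<beta> * f (z + x)) powr p) \<partial>lborel)"
proof -
  let ?w = "\<lambda>x. norm (\<alpha> * f x - \<beta> * f (z + x))"
  have shift: "(\<integral>\<^sup>+ x. ennreal (norm (f (z + x)) powr p) \<partial>lborel)
      = (\<integral>\<^sup>+ x. ennreal (norm (f x) powr p) \<partial>lborel)"
    by (rule nn_integral_lborel_translate) measurable
  have le1: "norm \<alpha> * norm (f x) \<le> ?w x + norm \<beta> * norm (f (z + x))" for x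
    using norm_triangle_sub[of "\<alpha> * f x" "\<beta> * f (z + x)"] by (simp add: norm_mult)
  have le2: "norm \<beta> * norm (f (z + x)) \<le> ?w x + norm \<alpha> * norm (f x)" for x
    using norm_triangle_sub[of "\<beta> * f (z + x)" "\<alpha> * f x"]
    by (simp add: norm_mult norm_minus_commute)
  consider "norm \<alpha> = norm \<beta>" | "norm \<beta> < norm \<alpha>" | "norm \<alpha> < norm \<beta>"
    by linarith
  then show ?thesis
  proof cases
    case 1
    then show ?thesis by simp
  next
    case 2
    then show ?thesis
      by (simp add: reverse_triangle_nn_integral[OF p _ 2 _ _ _ _ _ _ le1 refl shift fin])
  next
    case 3
    then show ?thesis
      by (simp add: reverse_triangle_nn_integral[OF p _ 3 _ _ _ _ _ _ le2 shift refl fin])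
  qed
qed

section \<open>From the completed measure to Borel functions\<close>

text \<open>
  The preimages of the countably many basic open sets differ from measurable sets by null
  sets; redefining the function to be constant on their union repairs all of them at once.
\<close>

lemma completion_borel_version:
  fixes f :: "'a \<Rightarrow> 'b::second_countable_topology"
  assumes f: "f \<in> borel_measurable (completion M)"
  obtains f' N where "f' \<in> borel_measurable M" "N \<in> null_sets M"
    "\<forall>x \<in> space M - N. f x = f' x"
proof -
  obtain B :: "'b set set" where B: "countable B" "topological_basis B"
    using ex_countable_basis by blast
  define P where "P b = f -` b \<inter> space M" for b
  have P: "P b \<in> sets (completion M)" if "b \<in> B" for b
    using measurable_sets[OF f, of b] topological_basis_open[OF B(2) that] by (simp add: P_def)
  have "\<forall>b\<in>B. \<exists>N. N \<in> null_sets M \<and> null_part M (P b) \<subseteq> N"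
    using null_part[OF P] by blast
  then obtain K where K: "\<And>b. b \<in> B \<Longrightarrow> K b \<in> null_sets M \<and> null_part M (P b) \<subseteq> K b"
    by metis
  define N where "N = (\<Union>b\<in>B. K b)"
  have N: "N \<in> null_sets M"
    unfolding N_def using B K by (intro null_sets_UN') auto
  define f' where "f' x = (if x \<in> N then undefined else f x)" for x
  have "f' \<in> measurable M (sigma UNIV B)"
  proof (rule measurable_measure_of)
    fix b assume b: "b \<in> B"
    have "null_part M (P b) \<subseteq> N"
      using K[OF b] b by (auto simp: N_def)
    with main_part_null_part_Un[OF P[OF b]] have "P b - N = main_part M (P b) - N"
      by blast
    moreover have "f' -` b \<inter> space M = (P b - N) \<union> (if undefined \<in> b then N else {})"
      using sets.sets_into_space[OF null_setsD2[OF N]] by (auto simp: f'_def P_def split: if_splits)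
    ultimately show "f' -` b \<inter> space M \<in> sets M"
      using P[OF b] N by (auto simp: null_setsD2)
  qed auto
  then have "f' \<in> borel_measurable M"
    by (simp add: borel_eq_countable_basis[OF B])
  moreover have "\<forall>x \<in> space M - N. f x = f' x"
    by (simp add: f'_def)
  ultimately show thesis
    using N that by blast
qed

text \<open>
  A property that holds almost everywhere in one variable holds almost everywhere on the
  product for \<open>x\<close>, \<open>y\<close>, \<open>y - x\<close> and \<open>x - y\<close>: for fixed \<open>x\<close> the differences are a translate
  and a reflection of \<open>y\<close>, which preserve null sets.
\<close>

lemma AE_lborel_pair:
  fixes N :: "'a::euclidean_space set"
  assumes N: "N \<in> null_sets lborel"
  shows "AE (x, y) in lborel. x \<notin> N \<and> y \<notin> N \<and> y - x \<notin> N \<and> x - y \<notin> N"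
proof -
  have [measurable]: "N \<in> sets borel"
    using N by auto
  have ae: "AE x in lborel. x \<notin> N"
    using N by (rule AE_not_in)
  have pred: "{x \<in> space borel. x \<notin> N} \<in> sets borel"
    by measurable
  have "AE y in lborel. y - x \<notin> N \<and> x - y \<notin> N" for x
  proof -
    have "AE y in distr lborel borel ((+) (- x)). y \<notin> N"
      and "AE y in distr lborel borel (\<lambda>y. x - y). y \<notin> N"
      using ae by (simp_all only: lborel_distr_plus lborel_distr_reflect)
    then show ?thesis
      using pred by (simp add: AE_distr_iff)
  qed
  then have "AE x in lborel. AE y in lborel. x \<notin> N \<and> y \<notin> N \<and> y - x \<notin> N \<and> x - y \<notin> N"
    using ae by auto
  then have "AE z in lborel \<Otimes>\<^sub>M lborel.
      fst z \<notin> N \<and> snd z \<notin> N \<and> snd z - fst z \<notin> N \<and> fst z - snd z \<notin> N"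
  proof (intro lborel_pair.AE_pair_measure)
    show "{z \<in> space (lborel \<Otimes>\<^sub>M lborel). fst z \<notin> N \<and> snd z \<notin> N
        \<and> snd z - fst z \<notin> N \<and> fst z - snd z \<notin> N} \<in> sets (lborel \<Otimes>\<^sub>M lborel)"
      by measurable
  qed simp
  then show ?thesis
    unfolding lborel_prod case_prod_beta .
qed

section \<open>The inequality\<close>

text \<open>
  Tonelli's theorem and the substitution \<open>y = x + z\<close>, for Borel functions.
\<close>

lemma product_difference_lower_bound_borel:
  fixes f g :: "'b::euclidean_space \<Rightarrow> 'a::{real_normed_field, second_countable_topology}"
  assumes p: "1 \<le> p" and [measurable]: "f \<in> borel_measurable borel" "g \<in> borel_measurable borel"
    and fin: "(\<integral>\<^sup>+ x. ennreal (norm (f x) powr p) \<partial>lborel) < \<infinity>"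
  shows "(\<integral>\<^sup>+ y. ennreal (\<bar>norm (g y) - norm (g (- y))\<bar> powr p) \<partial>lborel)
           * (\<integral>\<^sup>+ x. ennreal (norm (f x) powr p) \<partial>lborel)
         \<le> (\<integral>\<^sup>+ (x, y). ennreal (norm (g (y - x) * f x - g (x - y) * f y) powr p) \<partial>lborel)"
    (is "_ * ?I \<le> _")
proof -
  define h where "h x y = ennreal (norm (g (y - x) * f x - g (x - y) * f y) powr p)" for x y
  have [measurable]: "case_prod h \<in> borel_measurable (borel \<Otimes>\<^sub>M borel)"
    unfolding h_def by measurable
  have "(\<integral>\<^sup>+ z. ennreal (\<bar>norm (g z) - norm (g (- z))\<bar> powr p) \<partial>lborel) * ?I
      = (\<integral>\<^sup>+ z. ennreal (\<bar>norm (g z) - norm (g (- z))\<bar> powr p) * ?I \<partial>lborel)"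
    by (rule nn_integral_multc[symmetric]) measurable
  also have "\<dots> \<le> (\<integral>\<^sup>+ z. \<integral>\<^sup>+ x. h x (z + x) \<partial>lborel \<partial>lborel)"
  proof (rule nn_integral_mono)
    fix z
    show "ennreal (\<bar>norm (g z) - norm (g (- z))\<bar> powr p) * ?I \<le> (\<integral>\<^sup>+ x. h x (z + x) \<partial>lborel)"
      using translation_lower_bound[OF p _ fin, of "g z" "g (- z)" z] by (simp add: h_def)
  qed
  also have "\<dots> = (\<integral>\<^sup>+ x. \<integral>\<^sup>+ z. h x (z + x) \<partial>lborel \<partial>lborel)"
    by (rule lborel_pair.Fubini') measurable
  also have "\<dots> = (\<integral>\<^sup>+ x. \<integral>\<^sup>+ y. h x y \<partial>lborel \<partial>lborel)"
  proof (rule nn_integral_cong)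
    fix x :: 'b
    show "(\<integral>\<^sup>+ z. h x (z + x) \<partial>lborel) = (\<integral>\<^sup>+ y. h x y \<partial>lborel)"
      using nn_integral_lborel_translate[of "h x" x] by (simp add: add.commute)
  qed
  also have "\<dots> = (\<integral>\<^sup>+ z. case_prod h z \<partial>(lborel \<Otimes>\<^sub>M lborel))"
    using lborel.nn_integral_fst[of "case_prod h" lborel] by simp
  finally show ?thesis
    unfolding lborel_prod h_def .
qed

theorem mainTheorem14:
  fixes f g :: "real ^ 'm \<Rightarrow> 'a::{real_normed_field, second_countable_topology}"
    and p :: real
  assumes "1 \<le> p" and "f \<in> Lp p" and "g \<in> Lp p"
  shows "(\<integral>\<^sup>+ (x, y). ennreal (norm (g (y - x) * f x - g (x - y) * f y) powr p)
             \<partial>(lebesgue :: ((real ^ 'm) \<times> (real ^ 'm)) measure))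
         \<ge> (\<integral>\<^sup>+ y. ennreal (\<bar>norm (g y) - norm (g (- y))\<bar> powr p) \<partial>lebesgue)
            * (\<integral>\<^sup>+ x. ennreal (norm (f x) powr p) \<partial>lebesgue)"
proof -
  have "f \<in> borel_measurable lebesgue" "g \<in> borel_measurable lebesgue"
    and fin: "(\<integral>\<^sup>+ x. ennreal (norm (f x) powr p) \<partial>lborel) < \<infinity>"
    using assms(2,3) by (auto simp: Lp_def nn_integral_completion)
  obtain f' Nf where f': "f' \<in> borel_measurable lborel" and Nf: "Nf \<in> null_sets lborel"
    and f_f': "\<forall>x \<in> space lborel - Nf. f x = f' x"
    using completion_borel_version[OF \<open>f \<in> borel_measurable lebesgue\<close>] by blast
  obtain g' Ng where g': "g' \<in> borel_measurable lborel" and Ng: "Ng \<in> null_sets lborel"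
    and g_g': "\<forall>x \<in> space lborel - Ng. g x = g' x"
    using completion_borel_version[OF \<open>g \<in> borel_measurable lebesgue\<close>] by blast
  define N where "N = Nf \<union> Ng"
  have N_null: "N \<in> null_sets lborel"
    unfolding N_def using Nf Ng by (rule null_sets.Un)
  have eq: "f x = f' x" "g x = g' x" if "x \<notin> N" for x
    using that f_f' g_g' by (auto simp: N_def)
  note aep = AE_lborel_pair[OF N_null]
  have ae: "AE x in lborel. x \<notin> N"
    using N_null by (rule AE_not_in)
  have "AE x in distr lborel borel (\<lambda>x. 0 - x). x \<notin> N"
    using ae by (simp only: lborel_distr_reflect)
  then have ae_minus: "AE x in lborel. - x \<notin> N"
    using N_null by (subst (asm) AE_distr_iff) auto
  have f_eq: "(\<integral>\<^sup>+ x. ennreal (norm (f x) powr p) \<partial>lborel)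
      = (\<integral>\<^sup>+ x. ennreal (norm (f' x) powr p) \<partial>lborel)"
    using ae by (intro nn_integral_cong_AE) (auto simp: eq)
  have g_eq: "(\<integral>\<^sup>+ y. ennreal (\<bar>norm (g y) - norm (g (- y))\<bar> powr p) \<partial>lborel)
      = (\<integral>\<^sup>+ y. ennreal (\<bar>norm (g' y) - norm (g' (- y))\<bar> powr p) \<partial>lborel)"
    using ae ae_minus by (intro nn_integral_cong_AE) (auto simp: eq)
  have fg_eq: "(\<integral>\<^sup>+ (x, y). ennreal (norm (g (y - x) * f x - g (x - y) * f y) powr p) \<partial>lborel)
      = (\<integral>\<^sup>+ (x, y). ennreal (norm (g' (y - x) * f' x - g' (x - y) * f' y) powr p) \<partial>lborel)"
    using aep by (intro nn_integral_cong_AE) (auto simp: eq)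
  show ?thesis
    using product_difference_lower_bound_borel[OF assms(1), of f' g'] f' g' fin
    by (simp add: nn_integral_completion f_eq g_eq fg_eq)
qed

end
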